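(* Let $p$ be a prime, let $k$ be a positive integer, and let $G=\gamma_1\times\gamma_2\times\cdots\times\gamma_k$ be a torus (each $\gamma_i$ an undirected cycle) with $|G|=p^r$ for some positive integer $r$. Then $\mathrm{mrl}(G)\geq\lfloor k/3\rfloor+1$.
   Context: A torus is a Cartesian product $G=\gamma_1\times\gamma_2\times\cdots\times\gamma_k$ where each $\gamma_i$ is a cycle; it comes with this decomposition, the $\gamma_i$ are called the dimensions of $G$, and every edge of $G$ lies in exactly one dimension (the index $i$ of the coordinate that changes along the edge). A cycle has at least two vertices; a cycle on two vertices is allowed (as a closed walk it traverses back and forth between its two vertices). $|G|=\prod_i|\gamma_i|$ is the number of vertices of $G$. A Hamiltonian cycle in $G$ is a cycle passing through every vertex exactly once. The run length $\mathrm{rl}(H)$ of a Hamiltonian cycle $H$ in $G$ is the maximum $r$ such that any sequence of $r$ (cyclically) consecutive edges of $H$ contains no more than one edge in any one dimension. The maximum run length $\mathrm{mrl}(G)$ is the maximum of $\mathrm{rl}(H)$ over all Hamiltonian cycles $H$ in $G$. *)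

theory Defs
  imports "HOL-Computational_Algebra.Primes"
begin

text \<open>
  A torus is given by the list \<open>ns\<close> of the lengths of its dimensions: the dimension \<open>i\<close> is the
  undirected cycle on \<open>{0..<ns ! i}\<close>, with every residue joined to its successor modulo \<open>ns ! i\<close>.
  Length 2 is allowed.
\<close>

definition is_torus :: "nat list \<Rightarrow> bool" where
  "is_torus ns \<longleftrightarrow> (\<forall>n\<in>set ns. n \<ge> 2)"

definition cycle_adj :: "nat \<Rightarrow> nat \<Rightarrow> nat \<Rightarrow> bool" where
  "cycle_adj n a b \<longleftrightarrow> a < n \<and> b < n \<and> (b = Suc a mod n \<or> a = Suc b mod n)"

definition torus_verts :: "nat list \<Rightarrow> nat list set" where
  "torus_verts ns = {v. length v = length ns \<and> (\<forall>i<length ns. v ! i < ns ! i)}"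

definition edge_in_dim :: "nat list \<Rightarrow> nat \<Rightarrow> nat list \<Rightarrow> nat list \<Rightarrow> bool" where
  "edge_in_dim ns i v w \<longleftrightarrow>
     i < length ns \<and> v \<in> torus_verts ns \<and> w \<in> torus_verts ns \<and>
     cycle_adj (ns ! i) (v ! i) (w ! i) \<and> (\<forall>j<length ns. j \<noteq> i \<longrightarrow> v ! j = w ! j)"

definition torus_adj :: "nat list \<Rightarrow> nat list \<Rightarrow> nat list \<Rightarrow> bool" where
  "torus_adj ns v w \<longleftrightarrow> (\<exists>i. edge_in_dim ns i v w)"

text \<open>
  A Hamiltonian cycle is the list of its vertices in cyclic order, from an arbitrary starting point.
  On the two-vertex torus this is the closed walk that goes back and forth.
\<close>

definition hamiltonian_cycle :: "nat list \<Rightarrow> nat list list \<Rightarrow> bool" where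
  "hamiltonian_cycle ns h \<longleftrightarrow>
     distinct h \<and> set h = torus_verts ns \<and>
     (\<forall>j<length h. torus_adj ns (h ! j) (h ! (Suc j mod length h)))"

text \<open>
  The windows of \<open>r\<close> consecutive edges are counted by position along the closed walk, so the two
  traversals of the edge of the two-vertex torus count twice. Every window of more than
  \<open>length ns\<close> edges then repeats a dimension, so both maxima below range over finite sets.
\<close>

definition run_ok :: "nat list \<Rightarrow> nat list list \<Rightarrow> nat \<Rightarrow> bool" where
  "run_ok ns h r \<longleftrightarrow>
     (\<forall>s<length h. \<forall>i<length ns.
        card {j. j < r \<and>
          edge_in_dim ns i (h ! ((s + j) mod length h)) (h ! (Suc (s + j) mod length h))} \<le> 1)"

definition run_length :: "nat list \<Rightarrow> nat list list \<Rightarrow> nat" where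
  "run_length ns h = Max {r. run_ok ns h r}"

definition max_run_length :: "nat list \<Rightarrow> nat" where
  "max_run_length ns = Max {run_length ns h | h. hamiltonian_cycle ns h}"

end

theory Submission
  imports Defs "HOL-Number_Theory.Cong" "HOL-Combinatorics.Permutations"
begin

text \<open>
  Let \<open>d\<close> be the greatest common divisor of the orders of two tori. Walking along Hamiltonian cycles
  of both factors, a step in the first or the second according to the balanced word of slope
  \<open>s / d\<close>, is a Hamiltonian cycle of the product as soon as \<open>s\<close> and \<open>d - s\<close> are coprime to the two
  orders. For powers of \<open>p\<close> this only asks that \<open>p\<close> does not divide \<open>s\<close>, so \<open>s / d\<close> can be chosen close
  to \<open>1 / 2\<close>. Splitting \<open>3 q\<close> dimensions into two halves, each a multiple of 3, then turns runs of
  lengths \<open>q' + 1\<close> and \<open>q'' + 1\<close> into runs of length \<open>q' + q'' + 1\<close>.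

  The induction starts at three dimensions \<open>M \<ge> N \<ge> L\<close>, where no two consecutive edges may be parallel.
  There one takes a Hamiltonian closed walk in the quotient \<open>\<int>\<^sub>N \<times> \<int>\<^sub>L\<close> of \<open>\<int>\<^sub>M \<times> \<int>\<^sub>N \<times> \<int>\<^sub>L\<close> by a
  cyclic subgroup of order \<open>M\<close>, and repeats its lift \<open>M\<close> times.
\<close>

section \<open>Periodic walks with long runs\<close>

text \<open>
  The index runs over all natural numbers, so that the windows that wrap around the end of the
  Hamiltonian cycle need no separate treatment.
\<close>

definition long_run_walk :: "nat list \<Rightarrow> nat \<Rightarrow> (nat \<Rightarrow> nat list) \<Rightarrow> (nat \<Rightarrow> nat) \<Rightarrow> bool" where
  "long_run_walk ns r h c \<longleftrightarrow>
     inj_on h {..<prod_list ns} \<and>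
     (\<forall>j. edge_in_dim ns (c j) (h j) (h (Suc j)) \<and> h (j + prod_list ns) = h j \<and>
        inj_on c {j..<j + r})"

definition has_run :: "nat list \<Rightarrow> nat \<Rightarrow> bool" where
  "has_run ns r \<longleftrightarrow> (\<exists>h c. long_run_walk ns r h c)"

lemma torus_verts_append:
  assumes "v \<in> torus_verts xs" "w \<in> torus_verts ys"
  shows "v @ w \<in> torus_verts (xs @ ys)"
  using assms by (auto simp: torus_verts_def nth_append)

lemma edge_in_dim_append_left:
  assumes "edge_in_dim xs i v v'" "w \<in> torus_verts ys"
  shows "edge_in_dim (xs @ ys) i (v @ w) (v' @ w)"
proof -
  have "length v = length xs" "length v' = length xs"
    using assms(1) by (auto simp: edge_in_dim_def torus_verts_def)
  then show ?thesis
    using assms torus_verts_append[of v xs w ys] torus_verts_append[of v' xs w ys]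
    by (auto simp: edge_in_dim_def nth_append)
qed

lemma edge_in_dim_append_right:
  assumes "edge_in_dim ys i w w'" "v \<in> torus_verts xs"
  shows "edge_in_dim (xs @ ys) (length xs + i) (v @ w) (v @ w')"
proof -
  have "length v = length xs"
    using assms(2) by (auto simp: torus_verts_def)
  then show ?thesis
    using assms torus_verts_append[of v xs w ys] torus_verts_append[of v xs w' ys]
    by (auto simp: edge_in_dim_def nth_append)
qed

lemma periodic_mod:
  fixes h :: "nat \<Rightarrow> 'a"
  assumes "\<And>j. h (j + T) = h j"
  shows "h (j mod T) = h j"
proof -
  have "h (m + k * T) = h m" for m k
    by (induction k) (simp_all add: assms add.assoc[symmetric] add.commute[of T])
  from this[of "j mod T" "j div T"] show ?thesis
    by simp
qed

lemma long_run_walk_eq_iff: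
  assumes "long_run_walk ns r h c" "prod_list ns > 0"
  shows "h i = h j \<longleftrightarrow> [i = j] (mod prod_list ns)"
proof -
  have "h (i mod prod_list ns) = h i" "h (j mod prod_list ns) = h j"
    using assms(1) by (auto simp: long_run_walk_def intro!: periodic_mod)
  moreover have "h (i mod prod_list ns) = h (j mod prod_list ns) \<longleftrightarrow> i mod prod_list ns = j mod prod_list ns"
    using assms by (auto simp: long_run_walk_def inj_on_def)
  ultimately show ?thesis
    by (simp add: cong_def)
qed

lemma has_run_singleton:
  assumes "n > 0"
  shows "has_run [n] 1"
proof -
  have "long_run_walk [n] 1 (\<lambda>j. [j mod n]) (\<lambda>j. 0)"
    using assms
    by (auto simp: long_run_walk_def inj_on_def edge_in_dim_def torus_verts_def cycle_adj_def mod_Suc_eq)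
  then show ?thesis
    by (auto simp: has_run_def)
qed

section \<open>Products of two tori\<close>

text \<open>The two congruences add up to one modulo \<open>d\<close>, so
  \<open>j = i + d * k\<close> and the counts of steps grow by \<open>s * k\<close> and
  \<open>(d - s) * k\<close>. By coprimality both orders divide \<open>k\<close>, hence so does
  their lcm. As \<open>d\<close> times the lcm is \<open>T\<^sub>1 * T\<^sub>2\<close>, which
  exceeds \<open>j\<close>, this forces \<open>k = 0\<close>.\<close>

lemma cycle_word_inj:
  fixes s d T\<^sub>1 T\<^sub>2 i j :: nat
  assumes d: "d = gcd T\<^sub>1 T\<^sub>2" and s: "s \<le> d"
    and cop: "coprime s T\<^sub>1" "coprime (d - s) T\<^sub>2"
    and ij: "i < T\<^sub>1 * T\<^sub>2" "j < T\<^sub>1 * T\<^sub>2"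
    and eq1: "[i * s div d = j * s div d] (mod T\<^sub>1)"
    and eq2: "[i - i * s div d = j - j * s div d] (mod T\<^sub>2)"
  shows "i = j"
  using ij eq1 eq2
proof (induction i j rule: linorder_wlog)
  case (le i j)
  have d0: "d > 0"
    using d le by (cases "T\<^sub>1 = 0") auto
  have le_self: "m * s div d \<le> m" for m
    using d0 s by (metis div_le_mono mult_le_mono2 nonzero_mult_div_cancel_right less_not_refl2)
  have "[i * s div d + (i - i * s div d) = j * s div d + (j - j * s div d)] (mod d)"
    using d by (intro cong_add cong_dvd_modulus_nat[OF le(4)] cong_dvd_modulus_nat[OF le(5)]) auto
  then have "[j = i] (mod d)"
    using le_self by (simp add: cong_sym)
  then obtain k where "j = k * d + i"
    using le(1) by (auto simp: cong_le_nat)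
  then have k: "j = i + d * k"
    by simp
  have js: "j * s div d = i * s div d + s * k"
  proof -
    have "j * s = i * s + (s * k) * d" by (simp add: k algebra_simps)
    then show ?thesis using d0 by simp
  qed
  have "[s * k = 0] (mod T\<^sub>1)"
    using le(4) by (metis js cong_add_lcancel_0_nat cong_sym)
  then have "T\<^sub>1 dvd k"
    using cop(1) by (simp add: cong_0_iff coprime_dvd_mult_right_iff coprime_commute)
  have "d * k = (d - s) * k + s * k"
    using s by (simp add: algebra_simps)
  then have "j - j * s div d = (i - i * s div d) + (d - s) * k"
    using js k le_self[of i] by linarith
  then have "[(d - s) * k = 0] (mod T\<^sub>2)"
    using le(5) by (metis cong_add_lcancel_0_nat cong_sym)
  then have "T\<^sub>2 dvd k"
    using cop(2) by (simp add: cong_0_iff coprime_dvd_mult_right_iff coprime_commute)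
  with \<open>T\<^sub>1 dvd k\<close> have lk: "lcm T\<^sub>1 T\<^sub>2 dvd k"
    by simp
  have "d * k < d * lcm T\<^sub>1 T\<^sub>2"
    using le(3) k d by (metis le_add2 order_le_less_trans prod_gcd_lcm_nat)
  then have "k = 0"
    using lk d0 by (metis dvd_imp_le mult_less_cancel1 linorder_not_le not_gr_zero)
  then show ?case
    by (simp add: k)
next
  case (sym i j)
  then show ?case
    by (metis cong_sym)
qed

text \<open>
  The word makes \<open>\<lfloor>j s / d\<rfloor>\<close> of its first \<open>j\<close> steps in the first factor. So a window of length \<open>r\<close> has
  at most \<open>\<lceil>r s / d\<rceil>\<close> of them and at most \<open>\<lceil>r (d - s) / d\<rceil>\<close> steps in the second factor, which the
  last two hypotheses bound by \<open>A\<close> and \<open>B\<close>.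
\<close>

lemma has_run_append:
  assumes "has_run xs A" "has_run ys B"
    and pos: "prod_list xs > 0" "prod_list ys > 0"
    and d: "d = gcd (prod_list xs) (prod_list ys)" and s: "s \<le> d"
    and cop: "coprime s (prod_list xs)" "coprime (d - s) (prod_list ys)"
    and A: "r * s \<le> A * d" and B: "r * d \<le> r * s + B * d"
  shows "has_run (xs @ ys) r"
proof -
  obtain h\<^sub>1 c\<^sub>1 h\<^sub>2 c\<^sub>2 where w1: "long_run_walk xs A h\<^sub>1 c\<^sub>1" and w2: "long_run_walk ys B h\<^sub>2 c\<^sub>2"
    using assms(1,2) by (auto simp: has_run_def)
  note E = w1[unfolded long_run_walk_def] w2[unfolded long_run_walk_def]
  have e1: "edge_in_dim xs (c\<^sub>1 j) (h\<^sub>1 j) (h\<^sub>1 (Suc j))" and i1: "inj_on c\<^sub>1 {j..<j+A}" for j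
    using E(1) by auto
  have e2: "edge_in_dim ys (c\<^sub>2 j) (h\<^sub>2 j) (h\<^sub>2 (Suc j))" and i2: "inj_on c\<^sub>2 {j..<j+B}" for j
    using E(2) by auto
  have v1: "h\<^sub>1 j \<in> torus_verts xs" and v2: "h\<^sub>2 j \<in> torus_verts ys"
    and c1: "c\<^sub>1 j < length xs" for j
    using e1[of j] e2[of j] by (auto simp: edge_in_dim_def)
  have d0: "d > 0" using d pos by auto
  define a where "a j = j * s div d" for j
  define b where "b j = j - a j" for j
  define T where "T = prod_list (xs @ ys)"
  have a_le: "a j \<le> j" for j
    unfolding a_def using d0 s
    by (metis div_le_mono mult_le_mono2 nonzero_mult_div_cancel_right less_not_refl2)
  have a_mono: "a i \<le> a j" if "i \<le> j" for i j
    unfolding a_def using that by (simp add: div_le_mono)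
  have ab: "a j + b j = j" for j
    using a_le by (simp add: b_def)
  have a_Suc: "a (Suc j) = a j \<or> a (Suc j) = Suc (a j)" for j
  proof -
    have "a (Suc j) \<le> (j * s + d) div d"
      unfolding a_def using s by (intro div_le_mono) simp
    also have "\<dots> = Suc (a j)"
      using d0 by (simp add: a_def div_add_self2)
    finally show ?thesis using a_mono[of j "Suc j"] by linarith
  qed
  have b_mono: "b i \<le> b j" if "i \<le> j" for i j
    using that
  proof (induction rule: dec_induct)
    case (step n)
    then show ?case using a_Suc[of n] ab[of n] ab[of "Suc n"] by linarith
  qed simp
  have aA: "a (u + r) \<le> a u + A" for u
  proof -
    have "a (u + r) \<le> (u * s + A * d) div d"
      unfolding a_def using A by (intro div_le_mono) (simp add: algebra_simps)
    then show ?thesis using d0 by (simp add: a_def)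
  qed
  have bB: "b (u + r) \<le> b u + B" for u
  proof -
    have "(u * s + r * d) div d \<le> ((u + r) * s + B * d) div d"
      using B by (intro div_le_mono) (simp add: algebra_simps)
    then have "a u + r \<le> a (u + r) + B" using d0 by (simp add: a_def)
    then show ?thesis using ab[of u] ab[of "u + r"] by linarith
  qed
  \<comment> \<open>The period \<open>T\<close> consists of whole blocks of \<open>d\<close> steps,
    each with \<open>s\<close> steps in the first factor. So each factor advances by a multiple of
    its order.\<close>
  have a_per: "a (j + T) = a j + s * (prod_list ys div d) * prod_list xs" 
    and b_per: "b (j + T) = b j + (d - s) * (prod_list xs div d) * prod_list ys" for j
  proof -
    have dv: "d * (prod_list ys div d) = prod_list ys" "d * (prod_list xs div d) = prod_list xs"
      using d by auto
    have T: "T = d * (prod_list ys div d) * prod_list xs"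
      by (simp add: T_def dv mult.commute)
    then have "(j + T) * s = j * s + (s * (prod_list ys div d) * prod_list xs) * d"
      by (simp add: algebra_simps)
    then show 1: "a (j + T) = a j + s * (prod_list ys div d) * prod_list xs"
      using d0 unfolding a_def by simp
    have "(prod_list ys div d) * prod_list xs = (prod_list xs div d) * prod_list ys"
      by (metis dv mult.assoc mult.commute)
    moreover have "T = (s + (d - s)) * ((prod_list ys div d) * prod_list xs)"
      using s T by (simp add: mult.assoc)
    ultimately have "T = s * (prod_list ys div d) * prod_list xs + (d - s) * (prod_list xs div d) * prod_list ys"
      by (simp add: add_mult_distrib mult.assoc)
    then show "b (j + T) = b j + (d - s) * (prod_list xs div d) * prod_list ys"
      using 1 ab[of j] ab[of "j + T"] by linarith
  qed
  define h where "h j = h\<^sub>1 (a j) @ h\<^sub>2 (b j)" for j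
  define c where "c j = (if a (Suc j) = Suc (a j) then c\<^sub>1 (a j) else length xs + c\<^sub>2 (b j))" for j
  have "long_run_walk (xs @ ys) r h c"
    unfolding long_run_walk_def T_def[symmetric]
  proof (intro conjI allI)
    have len: "length (h\<^sub>1 i) = length (h\<^sub>1 j)" for i j
      using v1[of i] v1[of j] by (simp add: torus_verts_def)
    show "inj_on h {..<T}"
    proof (rule inj_onI)
      fix i j assume ij: "i \<in> {..<T}" "j \<in> {..<T}" "h i = h j"
      then have "h\<^sub>1 (a i) = h\<^sub>1 (a j)" "h\<^sub>2 (b i) = h\<^sub>2 (b j)"
        using len by (auto simp: h_def)
      then have "[a i = a j] (mod prod_list xs)" "[b i = b j] (mod prod_list ys)"
        using long_run_walk_eq_iff[OF w1] long_run_walk_eq_iff[OF w2] pos by auto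
      then show "i = j"
        using ij(1,2) unfolding a_def b_def
        by (intro cycle_word_inj[OF d s cop]) (simp_all add: T_def)
    qed
  next
    fix j
    show "edge_in_dim (xs @ ys) (c j) (h j) (h (Suc j))"
    proof (cases "a (Suc j) = Suc (a j)")
      case True
      then have "b (Suc j) = b j" using ab[of j] ab[of "Suc j"] by linarith
      then show ?thesis
        using True edge_in_dim_append_left[OF e1 v2] by (simp add: c_def h_def)
    next
      case False
      then have "a (Suc j) = a j" using a_Suc by blast
      moreover from this have "b (Suc j) = Suc (b j)" using ab[of j] ab[of "Suc j"] by linarith
      ultimately show ?thesis
        using edge_in_dim_append_right[OF e2 v1] by (simp add: c_def h_def)
    qed
    have "h\<^sub>1 (a (j + T)) = h\<^sub>1 (a j)" "h\<^sub>2 (b (j + T)) = h\<^sub>2 (b j)"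
      using pos by (simp_all add: long_run_walk_eq_iff[OF w1] long_run_walk_eq_iff[OF w2] a_per b_per cong_def)
    then show "h (j + T) = h j"
      by (simp add: h_def)
    show "inj_on c {j..<j + r}"
    proof (rule linorder_inj_onI)
      fix m n assume mn: "m < n" "m \<in> {j..<j + r}" "n \<in> {j..<j + r}"
      \<comment> \<open>Steps of the window in the first factor sit at distinct positions from
        \<open>a j\<close> up to below \<open>a j + A\<close>, where \<open>c\<^sub>1\<close> is
        injective; likewise in the second. Labels of different factors are kept apart by the shift
        \<open>length xs\<close>.\<close>
      have ord: "a j \<le> a m" "a m \<le> a (Suc m)" "a (Suc m) \<le> a n" "a n \<le> a (Suc n)" "a (Suc n) \<le> a j + A"
        "b j \<le> b m" "b m \<le> b (Suc m)" "b (Suc m) \<le> b n" "b n \<le> b (Suc n)" "b (Suc n) \<le> b j + B"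
        using mn a_mono b_mono order_trans[OF a_mono aA[of j]] order_trans[OF b_mono bB[of j]] by auto
      consider "a (Suc m) = Suc (a m)" "a (Suc n) = Suc (a n)"
        | "a (Suc m) = Suc (a m)" "a (Suc n) \<noteq> Suc (a n)"
        | "a (Suc m) \<noteq> Suc (a m)" "a (Suc n) = Suc (a n)"
        | "a (Suc m) \<noteq> Suc (a m)" "a (Suc n) \<noteq> Suc (a n)" by blast
      then show "c m \<noteq> c n"
      proof cases
        case 1
        then have "c\<^sub>1 (a m) \<noteq> c\<^sub>1 (a n)"
          using ord i1[of "a j"] by (auto dest!: inj_onD)
        with 1 show ?thesis by (simp add: c_def)
      next
        case 4
        then have "b (Suc m) = Suc (b m)" "b (Suc n) = Suc (b n)"
          using a_Suc[of m] a_Suc[of n] ab[of m] ab[of "Suc m"] ab[of n] ab[of "Suc n"] by linarith+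
        then have "c\<^sub>2 (b m) \<noteq> c\<^sub>2 (b n)"
          using ord i2[of "b j"] by (auto dest!: inj_onD)
        with 4 show ?thesis by (simp add: c_def)
      qed (use c1[of "a m"] c1[of "a n"] in \<open>auto simp: c_def\<close>)
    qed auto
  qed
  then show ?thesis
    by (auto simp: has_run_def)
qed

section \<open>Reordering the dimensions\<close>

lemma edge_in_dim_permute_list:
  assumes f: "f permutes {..<length xs}" and e: "edge_in_dim xs i v w"
  shows "edge_in_dim (permute_list f xs) (inv f i) (permute_list f v) (permute_list f w)"
proof -
  have len: "length v = length xs" "length w = length xs"
    using e by (auto simp: edge_in_dim_def torus_verts_def)
  have nth: "permute_list f u ! j = u ! f j" if "length u = length xs" "j < length xs" for u :: "nat list" and j
    using that f permute_list_nth[of f u j] by simp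
  have lt: "f j < length xs \<longleftrightarrow> j < length xs" for j
    using permutes_in_image[OF f, of j] by simp
  have "inv f i < length xs \<longleftrightarrow> i < length xs"
    using permutes_in_image[OF permutes_inv[OF f], of i] by simp
  moreover have "permute_list f u ! inv f i = u ! i" if "length u = length xs" for u :: "nat list"
    using that e nth calculation permutes_inverses(1)[OF f, of i] by (simp add: edge_in_dim_def)
  moreover have "f j \<noteq> i" if "j \<noteq> inv f i" for j
    using that permutes_inverses(2)[OF f] by metis
  ultimately show ?thesis
    using e len lt by (auto simp: edge_in_dim_def torus_verts_def nth)
qed

text \<open>Coordinates are permuted by \<open>f\<close> and labels by \<open>inv f\<close>. This
  permits sorting, since the constructions in three dimensions expect the longest one first.\<close>

lemma has_run_mset_cong:
  assumes "mset xs = mset ys" "has_run xs r"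
  shows "has_run ys r"
proof -
  obtain f where f: "f permutes {..<length xs}" and ys: "permute_list f xs = ys"
    using mset_eq_permutation[of ys xs] assms(1) by metis
  obtain h c where hc: "long_run_walk xs r h c"
    using assms(2) by (auto simp: has_run_def)
  have prod: "prod_list ys = prod_list xs"
    using assms(1) by (metis prod_mset_prod_list)
  have len: "length (h j) = length xs" for j
    using hc by (auto simp: long_run_walk_def edge_in_dim_def torus_verts_def)
  have inj: "h i = h j" if "permute_list f (h i) = permute_list f (h j)" for i j
  proof -
    have "permute_list (inv f) (permute_list f (h k)) = h k" for k
      using f permute_list_compose[of "inv f" "h k" f] permutes_inv[OF f] permutes_inv_o[OF f] len
      by simp
    then show ?thesis using that by metis
  qed
  have "long_run_walk ys r (\<lambda>j. permute_list f (h j)) (\<lambda>j. inv f (c j))"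
    unfolding long_run_walk_def prod
  proof (intro conjI allI)
    show "inj_on (\<lambda>j. permute_list f (h j)) {..<prod_list xs}"
      using hc inj by (auto simp: long_run_walk_def inj_on_def)
  next
    fix j
    show "edge_in_dim ys (inv f (c j)) (permute_list f (h j)) (permute_list f (h (Suc j)))"
      using hc edge_in_dim_permute_list[OF f] by (simp add: long_run_walk_def ys[symmetric])
    show "permute_list f (h (j + prod_list xs)) = permute_list f (h j)"
      using hc by (simp add: long_run_walk_def)
    have "inj (inv f)"
      using f permutes_inj permutes_inv by blast
    then have "inj_on (inv f) (c ` {j..<j + r})"
      by (rule inj_on_subset) simp
    moreover have "inj_on c {j..<j + r}"
      using hc by (simp add: long_run_walk_def)
    ultimately show "inj_on (\<lambda>j. inv f (c j)) {j..<j + r}"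
      using comp_inj_on[of c "{j..<j + r}" "inv f"] by (simp add: comp_def)
  qed
  then show ?thesis
    by (auto simp: has_run_def)
qed

section \<open>Three dimensions: lifting closed walks from a quotient\<close>

lemma cycle_adj_int:
  fixes a b :: int
  assumes "n > 0" "\<bar>b - a\<bar> = 1"
  shows "cycle_adj n (nat (a mod int n)) (nat (b mod int n))"
proof -
  have *: "nat ((x + 1) mod int n) = Suc (nat (x mod int n)) mod n" for x
  proof -
    have "int (Suc (nat (x mod int n)) mod n) = (x + 1) mod int n"
      using assms(1) by (simp add: zmod_int mod_simps add.commute)
    then show ?thesis by (metis nat_int)
  qed
  have "b = a + 1 \<or> a = b + 1"
    using assms(2) by linarith
  then show ?thesis
    using assms(1) *[of a] *[of b] by (auto simp: cycle_adj_def nat_less_iff)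
qed

text \<open>
  The quotient map is \<open>(x, y, z) \<mapsto> (y + u x, z + v x)\<close>, whose kernel is cyclic of order \<open>M\<close> and
  generated by \<open>(1, -u, -v)\<close>. The lift of the closed walk ends at a multiple of this generator by
  \<open>x (N * L)\<close>, so its \<open>M\<close> translates join up to a Hamiltonian cycle if this is coprime to \<open>M\<close>.
\<close>

lemma has_run_3_of_quotient_cycle:
  fixes M N L :: nat and x y z :: "nat \<Rightarrow> int" and c :: "nat \<Rightarrow> nat" and u v :: int
  assumes pos: "M > 0" "N > 0" "L > 0"
    and uv: "int N dvd u * int M" "int L dvd v * int M"
    and start: "x 0 = 0" "y 0 = 0" "z 0 = 0"
    and step: "\<And>j. j < N * L \<Longrightarrow>
        c j = 0 \<and> \<bar>x (Suc j) - x j\<bar> = 1 \<and> y (Suc j) = y j \<and> z (Suc j) = z j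
      \<or> c j = 1 \<and> x (Suc j) = x j \<and> \<bar>y (Suc j) - y j\<bar> = 1 \<and> z (Suc j) = z j
      \<or> c j = 2 \<and> x (Suc j) = x j \<and> y (Suc j) = y j \<and> \<bar>z (Suc j) - z j\<bar> = 1"
    and neq: "\<And>j. Suc j < N * L \<Longrightarrow> c j \<noteq> c (Suc j)" "c (N * L - 1) \<noteq> c 0"
    and inj: "\<And>i j. i < N * L \<Longrightarrow> j < N * L \<Longrightarrow>
        [y i + u * x i = y j + u * x j] (mod int N) \<Longrightarrow>
        [z i + v * x i = z j + v * x j] (mod int L) \<Longrightarrow> i = j"
    and closed: "int N dvd y (N * L) + u * x (N * L)" "int L dvd z (N * L) + v * x (N * L)"
    and cop: "coprime (x (N * L)) (int M)"
  shows "has_run [M, N, L] 2"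
proof -
  define T where "T = N * L"
  have T0: "T > 0" using pos by (simp add: T_def)
  \<comment> \<open>Repeats the walk forever in integer coordinates; each pass adds the total
    displacement \<open>f T\<close>.\<close>
  define E where "E f j = f (j mod T) + int (j div T) * f T" for f :: "nat \<Rightarrow> int" and j
  define C where "C j = c (j mod T)" for j
  define h where "h j = [nat (E x j mod int M), nat (E y j mod int N), nat (E z j mod int L)]" for j
  have Suc_cases: "Suc (j mod T) < T \<and> Suc j mod T = Suc (j mod T) \<and> Suc j div T = j div T
      \<or> Suc (j mod T) = T \<and> Suc j mod T = 0 \<and> Suc j div T = Suc (j div T)" for j
    using T0 by (auto simp: mod_Suc div_Suc Suc_lessI)
  have E_Suc: "E f (Suc j) - E f j = f (Suc (j mod T)) - f (j mod T)" if "f 0 = 0" for f j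
    using Suc_cases[of j] that by (auto simp: E_def algebra_simps)
  have edge: "edge_in_dim [M, N, L] (C j) (h j) (h (Suc j))" for j
  proof -
    have hv: "h i \<in> torus_verts [M, N, L]" for i
      using pos by (auto simp: h_def torus_verts_def less_Suc_eq nat_less_iff nth_Cons')
    have "C j = 0 \<and> \<bar>E x (Suc j) - E x j\<bar> = 1 \<and> E y (Suc j) = E y j \<and> E z (Suc j) = E z j
      \<or> C j = 1 \<and> E x (Suc j) = E x j \<and> \<bar>E y (Suc j) - E y j\<bar> = 1 \<and> E z (Suc j) = E z j
      \<or> C j = 2 \<and> E x (Suc j) = E x j \<and> E y (Suc j) = E y j \<and> \<bar>E z (Suc j) - E z j\<bar> = 1"
      using step[of "j mod T"] T0 E_Suc[of x, OF start(1), of j] E_Suc[of y, OF start(2), of j] E_Suc[of z, OF start(3), of j]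
      unfolding C_def T_def[symmetric] by auto
    then show ?thesis
      using hv[of j] hv[of "Suc j"] cycle_adj_int pos
      by (auto simp: edge_in_dim_def h_def less_Suc_eq)
  qed
  have per: "h (j + M * T) = h j" for j
  proof -
    have E: "E f (j + M * T) = E f j + int M * f T" for f
      using T0 by (simp add: E_def algebra_simps)
    have "[E x j + int M * x T = E x j] (mod int M)"
      by (simp add: cong_def)
    moreover have "int M * y T = int M * (y T + u * x T) - (u * int M) * x T"
      "int M * z T = int M * (z T + v * x T) - (v * int M) * x T"
      by (simp_all add: algebra_simps)
    then have "int N dvd int M * y T" "int L dvd int M * z T"
      using uv closed unfolding T_def[symmetric] by (simp_all only: dvd_diff dvd_mult dvd_mult2)
    then have "[E y j + int M * y T = E y j] (mod int N)" "[E z j + int M * z T = E z j] (mod int L)"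
      by (simp_all add: cong_iff_dvd_diff)
    ultimately show ?thesis
      by (simp add: h_def E cong_def)
  qed
  have inj_h: "inj_on h {..<M * T}"
  proof (rule inj_onI)
    fix i j assume ij: "i \<in> {..<M * T}" "j \<in> {..<M * T}" "h i = h j"
    have eq: "[E x i = E x j] (mod int M)" "[E y i = E y j] (mod int N)" "[E z i = E z j] (mod int L)"
      using ij(3) pos by (auto simp: h_def cong_def nat_eq_iff)
    \<comment> \<open>\<open>f + w * x\<close> is a coordinate of the quotient. The walk closes up
      there, so only the time within a pass matters.\<close>
    have red: "[E f k + w * E x k = f (k mod T) + w * x (k mod T)] (mod n)"
      if "n dvd f T + w * x T" for f w n k
    proof -
      have "E f k + w * E x k - (f (k mod T) + w * x (k mod T)) = int (k div T) * (f T + w * x T)"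
        by (simp add: E_def algebra_simps)
      then show ?thesis using that by (simp add: cong_iff_dvd_diff)
    qed
    \<comment> \<open>The quotient map is well defined: changing \<open>x\<close> by a multiple of
      \<open>M\<close> changes \<open>w * x\<close> by a multiple of \<open>n\<close>.\<close>
    have comb: "[E f i + w * E x i = E f j + w * E x j] (mod int n)"
      if "[E f i = E f j] (mod int n)" "int n dvd w * int M" for f w n
    proof -
      have "int n dvd w * (E x i - E x j)"
        using eq(1) by (intro dvd_trans[OF that(2)] mult_dvd_mono) (simp_all add: cong_iff_dvd_diff)
      then have "[w * E x i = w * E x j] (mod int n)"
        by (simp add: cong_iff_dvd_diff algebra_simps)
      then show ?thesis using that(1) by (intro cong_add)
    qed
    have "i mod T = j mod T"
    proof (rule inj)
      show "i mod T < N * L" "j mod T < N * L" using T0 by (simp_all add: T_def)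
      show "[y (i mod T) + u * x (i mod T) = y (j mod T) + u * x (j mod T)] (mod int N)"
        by (rule cong_trans[OF cong_sym[OF red] cong_trans[OF comb[OF eq(2) uv(1)] red]])
          (rule closed(1)[folded T_def])+
      show "[z (i mod T) + v * x (i mod T) = z (j mod T) + v * x (j mod T)] (mod int L)"
        by (rule cong_trans[OF cong_sym[OF red] cong_trans[OF comb[OF eq(3) uv(2)] red]])
          (rule closed(2)[folded T_def])+
    qed
    \<comment> \<open>Visits at the same time of two passes differ in \<open>x\<close> by a multiple
      of \<open>x T\<close>, and \<open>x T\<close> is invertible modulo \<open>M\<close>.\<close>
    moreover from this have "E x i - E x j = (int (i div T) - int (j div T)) * x T"
      by (simp add: E_def algebra_simps)
    then have "int M dvd int (i div T) - int (j div T)"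
      using eq(1) cop unfolding T_def[symmetric]
      by (simp add: cong_iff_dvd_diff coprime_commute coprime_dvd_mult_left_iff)
    then have "[i div T = j div T] (mod M)"
      by (simp add: cong_int_iff[symmetric] cong_iff_dvd_diff)
    moreover have "i div T < M" "j div T < M"
      using ij(1,2) by (simp_all add: less_mult_imp_div_less)
    ultimately have "i div T = j div T"
      by (simp add: cong_less_modulus_unique_nat)
    with \<open>i mod T = j mod T\<close> show "i = j"
      by (metis div_mult_mod_eq)
  qed
  have run: "inj_on C {j..<j + 2}" for j
  proof -
    have "C j \<noteq> C (Suc j)"
    proof (cases "Suc (j mod T) < T")
      case True
      then show ?thesis
        using Suc_cases[of j] neq(1)[of "j mod T"] by (simp add: C_def T_def)
    next
      case False
      then have "j mod T = T - 1" "Suc j mod T = 0"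
        using Suc_cases[of j] by auto
      then show ?thesis
        using neq(2) by (simp add: C_def T_def)
    qed
    moreover have "{j..<j + 2} = {j, Suc j}" by auto
    ultimately show ?thesis by auto
  qed
  have "long_run_walk [M, N, L] 2 h C"
    using inj_h edge per run by (auto simp: long_run_walk_def T_def)
  then show ?thesis
    by (auto simp: has_run_def)
qed

text \<open>
  The word \<open>X Y X Y\<^sup>- Z Y\<^sup>- Z\<^sup>- X\<^sup>- Z\<^sup>-\<close> was found by computer search. No word works when \<open>X\<close> and \<open>Y\<close>
  have the same image in the quotient.
\<close>

lemma has_run_M_3_3:
  assumes "M > 0" "3 dvd M"
  shows "has_run [M, 3, 3] 2"
\<comment> \<open>The coordinate tables include the end point, where \<open>x\<close> is 1 and hence
  coprime to \<open>M\<close>.\<close>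
proof (rule has_run_3_of_quotient_cycle[where u = 1 and v = 1
      and c = "\<lambda>j. [0, 1, 0, 1, 2, 1, 2, 0, 2] ! j"
      and x = "\<lambda>j. [0, 1, 1, 2, 2, 2, 2, 2, 1, 1] ! j"
      and y = "\<lambda>j. [0, 0, 1, 1, 0, 0, -1, -1, -1, -1] ! j"
      and z = "\<lambda>j. [0, 0, 0, 0, 0, 1, 1, 0, 0, -1] ! j"])
  have less_9: "j < 3 * 3 \<longleftrightarrow> j \<in> {0, 1, 2, 3, 4, 5, 6, 7, 8}" for j :: nat
    by auto
  let ?x = "\<lambda>j. [0, 1, 1, 2, 2, 2, 2, 2, 1, 1] ! j :: int"
  let ?y = "\<lambda>j. [0, 0, 1, 1, 0, 0, -1, -1, -1, -1] ! j :: int"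
  let ?z = "\<lambda>j. [0, 0, 0, 0, 0, 1, 1, 0, 0, -1] ! j :: int"
  \<comment> \<open>Entry \<open>3 * a + b\<close> of the list is the time at which the walk visits
    the vertex \<open>(a, b)\<close> of the quotient.\<close>
  have decode: "[0, 8, 3, 6, 1, 7, 5, 2, 4] ! nat (3 * ((?y i + 1 * ?x i) mod int 3) + (?z i + 1 * ?x i) mod int 3) = i"
    if "i < 3 * 3" for i
    using that unfolding less_9 by (elim insertE emptyE) simp_all
  show "i = j" if "i < 3 * 3" "j < 3 * 3" "[?y i + 1 * ?x i = ?y j + 1 * ?x j] (mod int 3)"
    "[?z i + 1 * ?x i = ?z j + 1 * ?x j] (mod int 3)" for i j :: nat
    using decode[OF that(1)] decode[OF that(2)] that(3,4) unfolding cong_def by metis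
  show "[0, 1, 0, 1, 2, 1, 2, 0, 2] ! j \<noteq> [0, 1, 0, 1, 2, 1, 2, 0, 2 :: nat] ! Suc j" 
    if "Suc j < 3 * 3" for j
  proof -
    have "j \<in> {0, 1, 2, 3, 4, 5, 6, 7}" using that by auto
    then show ?thesis by (elim insertE emptyE) simp_all
  qed
  show "[0, 1, 0, 1, 2, 1, 2, 0, 2] ! j = (0::nat) \<and> \<bar>?x (Suc j) - ?x j\<bar> = 1 \<and> ?y (Suc j) = ?y j \<and> ?z (Suc j) = ?z j
      \<or> [0, 1, 0, 1, 2, 1, 2, 0, 2] ! j = (1::nat) \<and> ?x (Suc j) = ?x j \<and> \<bar>?y (Suc j) - ?y j\<bar> = 1 \<and> ?z (Suc j) = ?z j
      \<or> [0, 1, 0, 1, 2, 1, 2, 0, 2] ! j = (2::nat) \<and> ?x (Suc j) = ?x j \<and> ?y (Suc j) = ?y j \<and> \<bar>?z (Suc j) - ?z j\<bar> = 1"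
    if "j < 3 * 3" for j
    using that unfolding less_9 by (elim insertE emptyE) simp_all
qed (use assms in auto)

lemma cong_int_imp_eq:
  fixes a b :: int
  assumes "[a = b] (mod int n)" "\<bar>a - b\<bar> < int n"
  shows "a = b"
  using assms by (metis cong_iff_dvd_diff dvd_imp_le_int abs_of_nat linorder_not_le right_minus_eq)

text \<open>
  Both \<open>X\<close> and \<open>Y\<close> map to the step to the right \<open>R\<close> of the quotient, so horizontal runs are labelled
  by \<open>X\<close> and \<open>Y\<close> alternately and only the vertical steps \<open>U\<close> and \<open>D\<close> need to be isolated. The walk is
  \<open>R\<^sup>2\<^sup>n U R\<^sup>- U R\<^sup>2\<^sup>n D (R\<^sup>-)\<^sup>2\<^sup>n\<^sup>-\<^sup>2 D\<close>: the two runs to the left share the row 1. Here \<open>w\<close> is the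
  horizontal coordinate before reduction modulo \<open>N\<close>.
\<close>

lemma has_run_M_N_3:
  assumes "M > 0" "n \<ge> 2" "N = 2 * n + 1" "N dvd M" "coprime (n + 1) M"
  shows "has_run [M, N, 3] 2"
proof -
  define x :: "nat \<Rightarrow> int" where
    "x j = (if j \<le> 2 * n then (int j + 1) div 2 else if j \<le> 2 * n + 2 then int n
      else if j \<le> 4 * n + 3 then (int j - 3) div 2
      else if j \<le> 6 * n + 2 then 4 * int n - (int j - 3) div 2 else int n + 1)" for j
  define w :: "nat \<Rightarrow> int" where
    "w j = (if j \<le> 2 * n then int j else if j \<le> 2 * n + 2 then 4 * int n + 1 - int j
      else if j \<le> 4 * n + 3 then int j - 4
      else if j \<le> 6 * n + 2 then 8 * int n + 3 - int j else 2 * int n + 1)" for j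
  define z :: "nat \<Rightarrow> int" where
    "z j = (if j \<le> 2 * n then 0 else if j \<le> 2 * n + 2 then 1
      else if j \<le> 4 * n + 3 then 2 else if j \<le> 6 * n + 2 then 1 else 0)" for j
  define c :: "nat \<Rightarrow> nat" where
    "c j = (if j \<in> {2 * n, 2 * n + 2, 4 * n + 3, 6 * n + 2} then 2 else if even j then 0 else 1)" for j
  define y where "y j = w j - x j" for j
  have N3: "N * 3 = 6 * n + 3" using assms(3) by simp
  show ?thesis
  proof (rule has_run_3_of_quotient_cycle[where u = 1 and v = 0 and x = x and y = y and z = z and c = c],
      unfold N3)
    fix j assume j: "j < 6 * n + 3"
    have "x (Suc j) - x j = (if c j = 0 then if j \<le> 4 * n + 3 then 1 else -1 else 0)"
    proof (cases "even j")
      case True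
      then obtain k where "j = 2 * k" by blast
      then show ?thesis using j assms(2) by (auto simp: x_def c_def)
    next
      case False
      then obtain k where "j = 2 * k + 1" by (elim oddE)
      then show ?thesis using j assms(2) by (auto simp: x_def c_def) presburger
    qed
    moreover have "\<bar>w (Suc j) - w j\<bar> = (if c j = 2 then 0 else 1)"
      using j assms(2) by (auto simp: w_def c_def)
    moreover have "\<bar>z (Suc j) - z j\<bar> = (if c j = 2 then 1 else 0)"
      using j assms(2) by (auto simp: z_def c_def)
    moreover have "w (Suc j) - w j = x (Suc j) - x j" if "c j = 0"
    proof -
      have cj: "even j" "j \<noteq> 2 * n" "j \<noteq> 4 * n + 3" "j \<noteq> 6 * n + 2" "j \<noteq> 2 * n + 2"
        using that by (auto simp: c_def split: if_splits)
      then have "j \<noteq> 2 * n + 1" by auto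
      then show ?thesis
        using that cj j assms(2) calculation(1) by (auto simp: w_def)
    qed
    moreover have "c j \<in> {0, 1, 2}"
      by (simp add: c_def)
    ultimately show "c j = 0 \<and> \<bar>x (Suc j) - x j\<bar> = 1 \<and> y (Suc j) = y j \<and> z (Suc j) = z j
      \<or> c j = 1 \<and> x (Suc j) = x j \<and> \<bar>y (Suc j) - y j\<bar> = 1 \<and> z (Suc j) = z j
      \<or> c j = 2 \<and> x (Suc j) = x j \<and> y (Suc j) = y j \<and> \<bar>z (Suc j) - z j\<bar> = 1"
      unfolding y_def by (auto split: if_splits)
  next
    fix j
    show "c j \<noteq> c (Suc j)" if "Suc j < 6 * n + 3"
      using assms(2) unfolding c_def by auto
    show "c (6 * n + 3 - 1) \<noteq> c 0"
      using assms(2) by (simp add: c_def)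
  next
    fix i j
    assume ij: "i < 6 * n + 3" "j < 6 * n + 3"
      and "[y i + 1 * x i = y j + 1 * x j] (mod int N)" "[z i + 0 * x i = z j + 0 * x j] (mod int 3)"
    then have w: "[w i = w j] (mod int N)" and "[z i = z j] (mod int 3)"
      by (simp_all add: y_def)
    then have z: "z i = z j"
      by (intro cong_int_imp_eq[of "z i" "z j" 3]) (auto simp: z_def)
    \<comment> \<open>In each of the rows 0, 1 and 2, \<open>w\<close> takes values among
      \<open>N\<close> consecutive integers, so congruent values are equal.\<close>
    then have "w i = w j"
      using w ij assms(2,3) by (intro cong_int_imp_eq[of "w i" "w j" N]) (auto simp: w_def z_def split: if_splits)
    with z ij assms(2) show "i = j"
      by (auto simp: w_def z_def split: if_splits)
  next
    \<comment> \<open>The two runs to the right contain \<open>n\<close> steps \<open>X\<close>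
      each, the long run to the left \<open>n - 1\<close> steps back, and the lone step to the left
      is a \<open>Y\<close>.\<close>
    have "x (6 * n + 3) = int (n + 1)" using assms(2) by (simp add: x_def)
    then show "coprime (x (6 * n + 3)) (int M)"
      using assms(5) by (simp only: coprime_int_iff)
  next
    show "int N dvd 1 * int M"
      using assms(4) by simp
    show "M > 0" "N > 0" "(3::nat) > 0"
      using assms(1,3) by simp_all
    show "x 0 = 0" "y 0 = 0" "z 0 = 0"
      by (simp_all add: x_def y_def z_def w_def)
    show "int N dvd y (6 * n + 3) + 1 * x (6 * n + 3)"
      using assms(3) by (simp add: y_def w_def add.commute)
    show "int 3 dvd 0 * int M" "int 3 dvd z (6 * n + 3) + 0 * x (6 * n + 3)"
      using assms(2) by (simp_all add: z_def)
  qed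
qed

text \<open>
  Again \<open>X\<close> and \<open>Y\<close> have the same image; the walk in the quotient is the one of
  \<open>cycle_word_inj\<close>, and \<open>L \<le> 2 * s\<close> isolates its vertical steps. The labels alternate with the
  number \<open>a j\<close> of horizontal steps, except that they are swapped from the vertical step \<open>m * L\<close> on.
  The swap adjusts the number of steps labelled \<open>X\<close> when \<open>p = 2\<close>; for \<open>m = N\<close> there is none.
\<close>

lemma has_run_M_N_L:
  assumes "M > 0" "L dvd N" "N dvd M" "coprime s N" "odd s" "s < L" "L \<le> 2 * s"
    and m: "odd m" "m \<le> N" and cop: "coprime (s * N div 2 + 1) M"
  shows "has_run [M, N, L] 2"
proof -
  define a where "a j = j * s div L" for j
  define x where "x j = (if j \<le> m * L then (a j + 1) div 2 else a j div 2 + 1)" for j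
  define c :: "nat \<Rightarrow> nat" where
    "c j = (if a (Suc j) = a j then 2 else if even (a j) = (j < m * L) then 0 else 1)" for j
  have L0: "L > 0" and N0: "N > 0"
    using assms by (auto intro: Nat.gr0I)
  have a_mono: "a i \<le> a j" if "i \<le> j" for i j
    unfolding a_def using that by (simp add: div_le_mono)
  have a_Suc: "a (Suc j) = a j \<or> a (Suc j) = Suc (a j)" for j
  proof -
    have "a (Suc j) \<le> (j * s + L) div L"
      unfolding a_def using assms by (intro div_le_mono) simp
    also have "\<dots> = Suc (a j)"
      using L0 by (simp add: a_def div_add_self2)
    finally show ?thesis using a_mono[of j "Suc j"] by linarith
  qed
  \<comment> \<open>\<open>L \<le> 2 * s\<close> ensures that of two adjacent steps at least one is
    horizontal.\<close>
  have a_Suc_Suc: "a (Suc (Suc j)) > a j" for j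
  proof -
    have "Suc (a j) = (j * s + L) div L"
      using L0 by (simp add: a_def div_add_self2)
    also have "\<dots> \<le> a (Suc (Suc j))"
      unfolding a_def using assms by (intro div_le_mono) simp
    finally show ?thesis by simp
  qed
  \<comment> \<open>Every step \<open>k * L\<close> is vertical. So neither the swap at
    \<open>m * L\<close> nor the return to step 0 falls between two adjacent horizontal
    steps.\<close>
  have a_L: "a (k * L) = k * s" and a_Suc_L: "a (Suc (k * L)) = k * s" for k
  proof -
    have *: "k * L * s = (k * s) * L" "Suc (k * L) * s = s + (k * s) * L"
      by simp_all
    show "a (k * L) = k * s" "a (Suc (k * L)) = k * s"
      using L0 assms(6) unfolding a_def * by simp_all
  qed
  have a_le: "a j \<le> j" for j
  proof (induction j)
    case (Suc j)
    then show ?case using a_Suc[of j] by auto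
  qed (simp add: a_def)
  \<comment> \<open>At an odd value of \<open>a\<close> the two formulas for \<open>x\<close> agree,
    so the count of steps \<open>X\<close> is continuous across the swap.\<close>
  have odd_mL: "odd (a (m * L))"
    using a_L m assms(5) by simp
  have x_ge: "x j = a j div 2 + 1" if "j \<ge> m * L" for j
    using that odd_mL by (auto simp: x_def elim!: oddE)
  have x_le: "x j \<le> a j" for j
  proof (cases "j \<le> m * L")
    case False
    then have "a j \<ge> 1"
      using odd_mL a_mono[of "m * L" j] by (cases "a (m * L)") auto
    with False show ?thesis by (simp add: x_def)
  qed (simp add: x_def)
  have x_Suc: "x (Suc j) = (if c j = 0 then Suc (x j) else x j)" for j
  proof (cases "j < m * L")
    case True
    then show ?thesis
      using a_Suc[of j] by (auto simp: x_def c_def)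
  next
    case False
    then show ?thesis
      using a_Suc[of j] by (auto simp: x_ge c_def)
  qed
  have T0: "Suc (N * L - 1) = N * L"
    using N0 L0 by simp
  show ?thesis
  proof (rule has_run_3_of_quotient_cycle[where u = 1 and v = 0 and x = "\<lambda>j. int (x j)" and c = c
      and y = "\<lambda>j. int (a j) - int (x j)" and z = "\<lambda>j. int j - int (a j)"])
    fix j
    show "c j = 0 \<and> \<bar>int (x (Suc j)) - int (x j)\<bar> = 1 \<and>
        int (a (Suc j)) - int (x (Suc j)) = int (a j) - int (x j) \<and>
        int (Suc j) - int (a (Suc j)) = int j - int (a j)
      \<or> c j = 1 \<and> int (x (Suc j)) = int (x j) \<and>
        \<bar>int (a (Suc j)) - int (x (Suc j)) - (int (a j) - int (x j))\<bar> = 1 \<and>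
        int (Suc j) - int (a (Suc j)) = int j - int (a j)
      \<or> c j = 2 \<and> int (x (Suc j)) = int (x j) \<and>
        int (a (Suc j)) - int (x (Suc j)) = int (a j) - int (x j) \<and>
        \<bar>int (Suc j) - int (a (Suc j)) - (int j - int (a j))\<bar> = 1"
      using x_Suc[of j] a_Suc[of j] by (auto simp: c_def)
    show "c j \<noteq> c (Suc j)"
    proof (cases "Suc j = m * L")
      case True
      then show ?thesis
        using a_L[of m] a_Suc_L[of m] a_Suc_Suc[of j] by (auto simp: c_def)
    next
      case False
      then show ?thesis
        using a_Suc_Suc[of j] a_Suc[of j] by (auto simp: c_def)
    qed
  next
    have "a (N * L - 1) < a (N * L)"
    proof -
      have "(N * L - 1) * s < (N * L) * s"
        using T0 odd_pos[OF assms(5)] by (intro mult_less_mono1) simp_all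
      then have "(N * L - 1) * s < (N * s) * L"
        by (simp add: mult_ac)
      then have "a (N * L - 1) < N * s"
        unfolding a_def by (simp add: less_mult_imp_div_less)
      then show ?thesis by (simp add: a_L)
    qed
    then have "c (N * L - 1) \<noteq> 2"
      unfolding c_def T0 by auto
    then show "c (N * L - 1) \<noteq> c 0"
      using a_L[of 0] a_Suc_L[of 0] by (simp add: c_def)
  next
    fix i j
    assume ij: "i < N * L" "j < N * L"
      and "[int (a i) - int (x i) + 1 * int (x i) = int (a j) - int (x j) + 1 * int (x j)] (mod int N)"
      and "[int i - int (a i) + 0 * int (x i) = int j - int (a j) + 0 * int (x j)] (mod int L)"
    then have "[int (a i) = int (a j)] (mod int N)" "[int (i - a i) = int (j - a j)] (mod int L)"
      using a_le by (simp_all add: of_nat_diff)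
    then have cong: "[a i = a j] (mod N)" "[i - a i = j - a j] (mod L)"
      by (simp_all only: cong_int_iff)
    have "coprime s L"
      by (rule coprime_divisors[OF dvd_refl assms(2,4)])
    moreover obtain t where t: "L = t + s"
      using assms(6) by (metis less_imp_add_positive add.commute)
    moreover have "gcd t (t + s) = gcd s (s + t)"
      by (simp add: gcd.commute)
    ultimately have "coprime (L - s) L"
      by (simp add: coprime_iff_gcd_eq_1 add.commute)
    moreover have "L = gcd N L"
      using assms(2) by (simp add: gcd_nat.absorb2)
    ultimately show "i = j"
      using cycle_word_inj[of L N L s i j] assms(4,6) ij cong[unfolded a_def] by linarith
  next
    have "x (N * L) = s * N div 2 + 1"
    proof (cases "m = N")
      case True
      then show ?thesis
        using x_ge[of "N * L"] by (simp add: a_L mult.commute[of s N])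
    next
      case False
      then show ?thesis
        using m L0 by (simp add: x_def a_L mult.commute[of s N])
    qed
    then show "coprime (int (x (N * L))) (int M)"
      using cop by (simp only: coprime_int_iff)
  qed (use assms L0 N0 a_L[of 0] in \<open>auto simp: a_L x_def\<close>)
qed

section \<open>One to three dimensions of prime power length\<close>

lemma gcd_prime_powers: "gcd (p ^ a) (p ^ b) = (p :: nat) ^ min a b"
  by (cases "a \<le> b")
    (simp_all add: gcd_nat.absorb1 gcd_nat.absorb2 le_imp_power_dvd min_def)

text \<open>Since \<open>p\<close> divides \<open>d\<close>, it divides \<open>s\<close> if and only
  if it divides \<open>d - s\<close>, so one condition gives both coprimalities.\<close>

lemma has_run_append_prime_powers:
  assumes "prime p" and ab: "prod_list xs = p ^ a" "prod_list ys = p ^ b"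
    and d: "d = p ^ min a b" "p dvd d" and s: "\<not> p dvd s" "s \<le> d"
    and "has_run xs A" "has_run ys B" "r * s \<le> A * d" "r * d \<le> r * s + B * d"
  shows "has_run (xs @ ys) r"
proof (rule has_run_append)
  have "\<not> p dvd d - s"
    using d(2) s dvd_diffD1 by blast
  then show "coprime s (prod_list xs)" "coprime (d - s) (prod_list ys)"
    using assms(1) s(1) unfolding ab
    by (simp_all add: prime_imp_coprime coprime_commute coprime_power_right_iff)
  show "d = gcd (prod_list xs) (prod_list ys)"
    by (simp add: ab d(1) gcd_prime_powers)
qed (use assms in \<open>auto simp: prime_gt_0_nat\<close>)

text \<open>Runs of length 1 impose nothing beyond Hamiltonicity, so the slope \<open>1 / d\<close>
  will do.\<close>

lemma has_run_pair:
  assumes "prime p" "a > 0" "b > 0"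
  shows "has_run [p ^ a, p ^ b] 1"
proof -
  have "p > 1" using assms(1) by (rule prime_gt_1_nat)
  moreover have "p dvd p ^ min a b"
    using assms by simp
  ultimately have "has_run ([p ^ a] @ [p ^ b]) 1"
    using assms has_run_singleton[of "p ^ a"] has_run_singleton[of "p ^ b"]
    by (intro has_run_append_prime_powers[of p _ a _ b "p ^ min a b" 1 1 1]) auto
  then show ?thesis by simp
qed

text \<open>\<open>has_run_M_N_L\<close> wants an odd \<open>s\<close>, prime to \<open>p\<close>,
  with \<open>L \<le> 2 * s\<close> and \<open>s < L\<close>: \<open>L - 1\<close> serves when
  \<open>p = 2\<close> and \<open>4\<close> divides \<open>L\<close>, and \<open>L - 2\<close> when
  \<open>L\<close> is odd and at least 5. For \<open>L = 3\<close> there is no such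
  \<open>s\<close>.\<close>

lemma has_run_sorted_triple:
  assumes p: "prime p" and abc: "b \<le> a" "c \<le> b" "c > 0"
  shows "has_run [p ^ a, p ^ b, p ^ c] 2"
proof -
  define M N L where MNL: "M = p ^ a" "N = p ^ b" "L = p ^ c"
  have pL: "p dvd L" and dv: "L dvd N" "N dvd M" and pos: "M > 0" "N > 0" "L > 0"
    using abc p by (auto simp: MNL le_imp_power_dvd prime_gt_0_nat)
  have coprime_iff: "coprime t M" "coprime t N" if "\<not> p dvd t" for t
    using that p by (simp_all add: MNL prime_imp_coprime coprime_commute coprime_power_right_iff)
  have "has_run [M, N, L] 2"
  proof (cases "p = 2")
    case p2: True
    show ?thesis
    proof (cases "c = 1")
      case True
      \<comment> \<open>With \<open>d = 2\<close> and \<open>s = 1\<close> the steps alternate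
        between the two factors, so runs of length 1 in each suffice.\<close>
      have "has_run ([M, N] @ [L]) 2"
        using p2 True abc p has_run_pair[OF p, of a b] has_run_singleton[of L] pos
        by (intro has_run_append_prime_powers[of p _ "a + b" _ 1 2 1 1 1]) (auto simp: MNL power_add)
      then show ?thesis by simp
    next
      case False
      then obtain e where "c = e + 2"
        using abc(3) by (metis One_nat_def Suc_lessI add_2_eq_Suc' less_imp_Suc_add plus_1_eq_Suc add.commute)
      then have "4 dvd L" by (simp add: MNL p2)
      then obtain l where l: "L = 4 * l" by blast
      obtain n where n: "N = 4 * n"
        using \<open>4 dvd L\<close> dv(1) by (meson dvd_def dvd_trans)
      have "odd (L - 1)" using l pos by simp
      show ?thesis
      proof (rule has_run_M_N_L[where s = "L - 1" and m = 1])
        show "coprime (L - 1) N"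
          using \<open>odd (L - 1)\<close> by (intro coprime_iff) (simp add: p2)
        \<comment> \<open>Half of \<open>N\<close> is even, so the swap makes the number of steps
          \<open>X\<close> odd.\<close>
        have "(L - 1) * N div 2 + 1 = 2 * ((L - 1) * n) + 1"
          by (simp add: n)
        then show "coprime ((L - 1) * N div 2 + 1) M"
          by (intro coprime_iff) (simp add: p2)
      qed (use \<open>odd (L - 1)\<close> dv pos l in auto)
    qed
  next
    case False
    then have p3: "p \<ge> 3" "odd p"
      using p prime_ge_2_nat[OF p] prime_odd_nat[OF p] by auto
    then have odd: "odd L" "odd N" by (simp_all add: MNL)
    have not_dvd_2: "\<not> p dvd 2"
      using p3 by (auto dest: dvd_imp_le)
    show ?thesis
    proof (cases "L \<ge> 5")
      case True
      have "odd (L - 2)" using odd True by simp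
      show ?thesis
      proof (rule has_run_M_N_L[where s = "L - 2" and m = N])
        have "\<not> p dvd L - 2"
          using pL not_dvd_2 True by (metis dvd_diffD1 le_trans numeral_le_iff semiring_norm(68,71,72))
        then show "coprime (L - 2) N"
          by (rule coprime_iff)
        have "odd ((L - 2) * N)"
          using odd \<open>odd (L - 2)\<close> by simp
        \<comment> \<open>Twice the number of steps \<open>X\<close> is 1 modulo
          \<open>p\<close>.\<close>
        then have "2 * ((L - 2) * N div 2 + 1) = (L - 2) * N + 1"
          by presburger
        moreover have "\<not> p dvd (L - 2) * N + 1"
          using pL dv(1) p by (metis dvd_add_right_iff dvd_mult dvd_trans not_prime_unit)
        ultimately have "\<not> p dvd (L - 2) * N div 2 + 1"
          by (metis dvd_mult)
        then show "coprime ((L - 2) * N div 2 + 1) M"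
          by (rule coprime_iff)
      qed (use \<open>odd (L - 2)\<close> dv pos odd True in auto)
    next
      case False
      have "p \<le> L" using pL pos by (simp add: dvd_imp_le)
      moreover have "L \<noteq> 4" using odd by auto
      ultimately have L3: "L = 3" and p_eq: "p = 3" using p3 False by auto
      show ?thesis
      \<comment> \<open>For \<open>N = 3\<close> the last run to the left in the word of
        \<open>has_run_M_N_3\<close> would be empty and its two steps \<open>D\<close>
        adjacent.\<close>
      proof (cases "N = 3")
        case True
        then show ?thesis
          using has_run_M_3_3[of M] pos dv L3 by simp
      next
        case False
        obtain n where n: "N = 2 * n + 1"
          using odd by (auto elim: oddE)
        have "3 dvd N" using dv L3 by simp
        have "n \<ge> 2"
          using n False pos \<open>3 dvd N\<close> by presburger
        moreover have "\<not> p dvd n + 1"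
          using n \<open>3 dvd N\<close> unfolding p_eq by presburger
        ultimately show ?thesis
          using has_run_M_N_3[of M n N] pos dv n coprime_iff[of "n + 1"] L3 by simp
      qed
    qed
  qed
  then show ?thesis by (simp add: MNL)
qed

lemma has_run_triple:
  assumes p: "prime p" and ns: "length ns = 3" "\<forall>n\<in>set ns. \<exists>e>0. n = p ^ e"
  shows "has_run ns 2"
proof -
  define xs where "xs = sort ns"
  have "length xs = 3" "set xs = set ns" "sorted xs"
    using ns(1) by (simp_all add: xs_def)
  then obtain L N M where xs: "xs = [L, N, M]" and le: "L \<le> N" "N \<le> M"
    by (auto simp: length_Suc_conv numeral_3_eq_3)
  obtain a b c where "M = p ^ a" "N = p ^ b" "L = p ^ c" "c > 0"
    using ns(2) \<open>set xs = set ns\<close> unfolding xs by (metis list.set_intros)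
  moreover from this have "c \<le> b" "b \<le> a"
    using le prime_gt_1_nat[OF p] by (auto dest: power_le_imp_le_exp)
  ultimately have "has_run [M, N, L] 2"
    using has_run_sorted_triple[OF p, of b a c] by simp
  moreover have "mset [M, N, L] = mset xs"
    by (simp add: xs)
  ultimately show ?thesis
    using has_run_mset_cong[of "[M, N, L]" ns 2] by (simp add: xs_def)
qed

section \<open>Induction on the number of dimensions\<close>

lemma prod_list_prime_powers:
  assumes "\<forall>n\<in>set ns. \<exists>e>0. n = (p :: nat) ^ e"
  shows "\<exists>e\<ge>length ns. prod_list ns = p ^ e"
  using assms
proof (induction ns)
  case (Cons n ns)
  then obtain e f where "e > 0" "n = p ^ e" "f \<ge> length ns" "prod_list ns = p ^ f"
    by auto
  then show ?case
    by (intro exI[of _ "e + f"]) (simp add: power_add)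
qed (auto intro: exI[of _ 0])

text \<open>The witnesses are \<open>d / 2 + 1\<close> and \<open>d / 2 - 1\<close> for
  \<open>p = 2\<close>, where \<open>m \<ge> 2\<close> makes \<open>d / 2\<close> even, and
  \<open>(d + 1) / 2\<close> and \<open>(d - 1) / 2\<close> for odd \<open>p\<close>.\<close>

lemma half_prime_power_approx:
  fixes p d m :: nat
  assumes "prime p" "d = p ^ m" "m \<ge> 2"
  obtains s s' where "\<not> p dvd s" "d \<le> 2 * s" "2 * s \<le> d + 2"
    and "\<not> p dvd s'" "d \<le> 2 * s' + 2" "2 * s' \<le> d"
proof (cases "p = 2")
  case True
  obtain e where "m = e + 2"
    using assms(3) by (metis add.commute le_Suc_ex)
  then have "d = 4 * 2 ^ e" using assms(2) True by simp
  then show thesis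
    using that[of "2 * 2 ^ e + 1" "2 * 2 ^ e - 1"] True by simp
next
  case False
  then have "odd p" using assms(1) prime_ge_2_nat[OF assms(1)] prime_odd_nat[of p] by auto
  then have "odd d" using assms(2) by simp
  then obtain e where e: "d = 2 * e + 1" by (elim oddE)
  have "p dvd d" using assms by simp
  have "\<not> p dvd e + 1"
  proof
    assume "p dvd e + 1"
    then have "p dvd 2 * (e + 1)" by (rule dvd_mult)
    then have "p dvd d + 1" by (simp add: e)
    with \<open>p dvd d\<close> assms(1) show False by (metis dvd_add_right_iff not_prime_unit)
  qed
  moreover have "\<not> p dvd e"
  proof
    assume "p dvd e"
    then have "p dvd 2 * e" by (rule dvd_mult)
    with \<open>p dvd d\<close> assms(1) show False by (metis e dvd_add_right_iff not_prime_unit)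
  qed
  ultimately show thesis
    using that[of "e + 1" e] by (simp add: e)
qed

text \<open>Four or five dimensions lose their last one, which does not change the bound. From six
  on, the first part has \<open>3 * q\<^sub>1\<close> dimensions, so that no rounding is lost in the
  split.\<close>

lemma has_run_prime_powers:
  assumes p: "prime p" and "ns \<noteq> []" "\<forall>n\<in>set ns. \<exists>e>0. n = p ^ e"
  shows "has_run ns (length ns div 3 + 1)"
  using assms(2,3)
proof (induction ns rule: length_induct)
  case (1 ns)
  define q where "q = length ns div 3"
  have p1: "p > 1" using p by (rule prime_gt_1_nat)
  consider "length ns = 1" | "length ns = 2" | "length ns = 3" | "length ns \<in> {4, 5}" | "length ns \<ge> 6"
    using "1.prems"(1) by (cases "length ns") (auto, linarith?)
  then show ?case
  proof cases
    case 1
    then obtain n where "ns = [n]" by (auto simp: length_Suc_conv)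
    then show ?thesis using has_run_singleton[of n] "1.prems"(2) p1 by auto
  next
    case 2
    then obtain m n where "ns = [m, n]" by (auto simp: length_Suc_conv numeral_2_eq_2)
    then show ?thesis using has_run_pair[OF p] "1.prems"(2) by auto
  next
    case 3
    then show ?thesis using has_run_triple[OF p] "1.prems"(2) by (simp add: numeral_2_eq_2)
  next
    case 4
    define xs y where "xs = butlast ns" and "y = last ns"
    have ns: "ns = xs @ [y]" using "1.prems"(1) by (simp add: xs_def y_def)
    have "length xs div 3 = 1" using 4 ns by auto
    moreover have "has_run xs (length xs div 3 + 1)"
      using "1.IH" "1.prems"(2) 4 ns by auto
    ultimately have xs: "has_run xs 2" by (simp add: numeral_2_eq_2)
    obtain a where a: "a \<ge> length xs" "prod_list xs = p ^ a"
      using prod_list_prime_powers[of xs p] "1.prems"(2) by (auto simp: ns)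
    then have "a > 0"
      using \<open>length xs div 3 = 1\<close> by (intro gr0I) auto
    obtain b where b: "b > 0" "y = p ^ b"
      using "1.prems"(2) ns by auto
    define d where "d = p ^ min a b"
    have d: "p dvd d" using \<open>a > 0\<close> b by (simp add: d_def)
    moreover have "d \<ge> 2"
      using d p1 dvd_imp_le[OF d] by (simp add: d_def)
    \<comment> \<open>With slope \<open>(d - 1) / d\<close>, at most one of two consecutive steps is
      in \<open>y\<close>, and \<open>xs\<close> already has runs of length 2.\<close>
    moreover have "\<not> p dvd d - 1"
      using d p \<open>d \<ge> 2\<close> by (metis dvd_diffD1 not_prime_unit one_le_numeral order_trans)
    ultimately have "has_run (xs @ [y]) 2"
      using a b xs has_run_singleton[of y] p1
      by (intro has_run_append_prime_powers[OF p, of xs a "[y]" b d "d - 1" 2 1]) (auto simp: d_def)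
    moreover have "length ns div 3 + 1 = 2" using 4 by auto
    ultimately show ?thesis by (simp only: ns)
  next
    case 5
    define q\<^sub>1 where "q\<^sub>1 = q div 2"
    define xs ys where "xs = take (3 * q\<^sub>1) ns" and "ys = drop (3 * q\<^sub>1) ns"
    have ns: "ns = xs @ ys" by (simp add: xs_def ys_def)
    have q: "q \<ge> 2" "3 * q \<le> length ns" "q\<^sub>1 \<ge> 1" "2 * q\<^sub>1 \<le> q" "q \<le> 2 * q\<^sub>1 + 1"
      using 5 by (auto simp: q_def q\<^sub>1_def)
    have len: "length xs = 3 * q\<^sub>1" "length ys = length ns - 3 * q\<^sub>1"
      using q by (simp_all add: xs_def ys_def)
    have "length xs div 3 = q\<^sub>1" "length ys div 3 = q - q\<^sub>1"
      using q by (auto simp: len q_def)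
    moreover have "length xs < length ns" "xs \<noteq> []" "length ys < length ns" "ys \<noteq> []"
      using q len by auto
    moreover have sub: "set xs \<subseteq> set ns" "set ys \<subseteq> set ns"
      by (simp_all add: ns)
    ultimately have "has_run xs (length xs div 3 + 1)" "has_run ys (length ys div 3 + 1)"
      using "1.IH" "1.prems"(2) by blast+
    with \<open>length xs div 3 = q\<^sub>1\<close> \<open>length ys div 3 = q - q\<^sub>1\<close> have runs: "has_run xs (q\<^sub>1 + 1)" "has_run ys (q - q\<^sub>1 + 1)"
      by simp_all
    obtain a where a: "a \<ge> 3 * q\<^sub>1" "prod_list xs = p ^ a"
      using prod_list_prime_powers[of xs p] "1.prems"(2) sub(1) len(1) by auto
    obtain b where b: "b \<ge> length ys" "prod_list ys = p ^ b"
      using prod_list_prime_powers[of ys p] "1.prems"(2) sub(2) by auto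
    define m where "m = min a b"
    define d where "d = p ^ m"
    have m: "m \<ge> 3 * q\<^sub>1"
      using a b q len by (simp add: m_def)
    \<comment> \<open>The slope is off from \<open>1 / 2\<close> by at most \<open>1 / d\<close>.
      This bound keeps the resulting error below the slack left in a window of \<open>q + 1\<close>
      steps.\<close>
    have "4 * q\<^sub>1 + 2 \<le> (8 :: nat) ^ q\<^sub>1"
      using q(3) by (induction q\<^sub>1 rule: dec_induct) auto
    also have "(8 :: nat) ^ q\<^sub>1 = 2 ^ (3 * q\<^sub>1)"
      by (simp add: power_mult)
    also have "\<dots> \<le> p ^ (3 * q\<^sub>1)"
      using p1 by (intro power_mono) auto
    also have "\<dots> \<le> d"
      unfolding d_def using m p1 by (intro power_increasing) auto
    finally have d_ge: "4 * q\<^sub>1 + 2 \<le> d" .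
    have "p dvd d" "m \<ge> 2"
      using m q by (simp_all add: d_def)
    obtain s s' where s: "\<not> p dvd s" "d \<le> 2 * s" "2 * s \<le> d + 2"
      and s': "\<not> p dvd s'" "d \<le> 2 * s' + 2" "2 * s' \<le> d"
      by (rule half_prime_power_approx[OF p d_def \<open>m \<ge> 2\<close>])
    have "has_run (xs @ ys) (q + 1)"
    proof (cases "q = 2 * q\<^sub>1")
      \<comment> \<open>The window has \<open>2 * q\<^sub>1 + 1\<close> steps and both factors allow
        \<open>q\<^sub>1 + 1\<close>, so a slope slightly above \<open>1 / 2\<close> fits.\<close>
      case True
      show ?thesis
      proof (rule has_run_append_prime_powers[OF p a(2) b(2) _ \<open>p dvd d\<close> s(1) _ runs])
        have "(2 * q\<^sub>1 + 1) * (2 * s) \<le> (2 * q\<^sub>1 + 1) * (d + 2)"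
          using s(3) by (rule mult_le_mono2)
        then show "(q + 1) * s \<le> (q\<^sub>1 + 1) * d"
          using d_ge True by (simp add: algebra_simps)
        have "(2 * q\<^sub>1 + 1) * d \<le> (2 * q\<^sub>1 + 1) * (2 * s)"
          using s(2) by (rule mult_le_mono2)
        then show "(q + 1) * d \<le> (q + 1) * s + (q - q\<^sub>1 + 1) * d"
          using True by (simp add: algebra_simps)
      qed (use s d_ge in \<open>auto simp: d_def m_def\<close>)
    next
      case False
      \<comment> \<open>Now the first factor allows exactly half of the
        \<open>2 * q\<^sub>1 + 2\<close> steps, so the slope must not exceed
        \<open>1 / 2\<close>.\<close>
      then have q_eq: "q = 2 * q\<^sub>1 + 1" using q by linarith
      show ?thesis
      proof (rule has_run_append_prime_powers[OF p a(2) b(2) _ \<open>p dvd d\<close> s'(1) _ runs])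
        have "(q\<^sub>1 + 1) * (2 * s') \<le> (q\<^sub>1 + 1) * d"
          using s'(3) by (rule mult_le_mono2)
        then show "(q + 1) * s' \<le> (q\<^sub>1 + 1) * d"
          using q_eq by (simp add: algebra_simps)
        have "(q\<^sub>1 + 1) * d \<le> (q\<^sub>1 + 1) * (2 * s' + 2)"
          using s'(2) by (rule mult_le_mono2)
        then show "(q + 1) * d \<le> (q + 1) * s' + (q - q\<^sub>1 + 1) * d"
          using q_eq d_ge by (simp add: algebra_simps)
      qed (use s' d_ge in \<open>auto simp: d_def m_def\<close>)
    qed
    then show ?thesis by (simp add: ns[symmetric] q_def)
  qed
qed

section \<open>From periodic walks to the maximum run length\<close>

lemma finite_card_torus_verts: "finite (torus_verts ns) \<and> card (torus_verts ns) = prod_list ns"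
proof (induction ns)
  case Nil
  have "torus_verts [] = {[]}" by (auto simp: torus_verts_def)
  then show ?case by simp
next
  case (Cons n ns)
  have eq: "torus_verts (n # ns) = (\<lambda>(a, v). a # v) ` ({..<n} \<times> torus_verts ns)"
  proof (intro equalityI subsetI)
    fix v assume v: "v \<in> torus_verts (n # ns)"
    then obtain a w where "v = a # w" by (cases v) (auto simp: torus_verts_def)
    with v show "v \<in> (\<lambda>(a, v). a # v) ` ({..<n} \<times> torus_verts ns)"
      by (auto simp: torus_verts_def image_iff)
  next
    fix v assume "v \<in> (\<lambda>(a, v). a # v) ` ({..<n} \<times> torus_verts ns)"
    then show "v \<in> torus_verts (n # ns)"
      by (auto simp: torus_verts_def nth_Cons split: nat.split)
  qed
  have "inj_on (\<lambda>(a, v). a # v) ({..<n} \<times> torus_verts ns)"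
    by (auto simp: inj_on_def)
  then show ?case
    using Cons by (simp add: eq card_image card_cartesian_product)
qed

text \<open>Lengths of at least 2 exclude loops, which would lie in several dimensions at once. So
  the labels of a walk are the dimensions of its edges.\<close>

lemma edge_in_dim_unique:
  assumes "is_torus ns" "edge_in_dim ns i v w" "edge_in_dim ns j v w"
  shows "i = j"
proof (rule ccontr)
  assume "i \<noteq> j"
  then have "v ! i = w ! i" "i < length ns" "cycle_adj (ns ! i) (v ! i) (w ! i)"
    using assms(2,3) by (auto simp: edge_in_dim_def)
  moreover have "ns ! i \<ge> 2"
    using assms(1) \<open>i < length ns\<close> by (simp add: is_torus_def)
  ultimately show False
    by (auto simp: cycle_adj_def mod_Suc split: if_splits)
qed

text \<open>By pigeonhole: every edge of the window lies in some dimension, and each dimension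
  occurs at most once. This makes the \<open>Max\<close> in \<open>run_length\<close> one over a
  finite set.\<close>

lemma run_ok_le_length:
  assumes "hamiltonian_cycle ns h" "h \<noteq> []" "run_ok ns h r"
  shows "r \<le> length ns"
proof -
  define S where "S i = {j. j < r \<and>
    edge_in_dim ns i (h ! ((0 + j) mod length h)) (h ! (Suc (0 + j) mod length h))}" for i
  have card_S: "card (S i) \<le> 1" if "i < length ns" for i
    using assms(2,3) that unfolding run_ok_def S_def by blast
  have "{..<r} \<subseteq> (\<Union>i<length ns. S i)"
  proof
    fix j assume "j \<in> {..<r}"
    have "torus_adj ns (h ! (j mod length h)) (h ! (Suc (j mod length h) mod length h))"
      using assms(1,2) by (simp add: hamiltonian_cycle_def)
    then obtain i where i: "edge_in_dim ns i (h ! (j mod length h)) (h ! (Suc j mod length h))"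
      by (auto simp: torus_adj_def mod_Suc_eq)
    then have "i < length ns" by (simp add: edge_in_dim_def)
    with i \<open>j \<in> {..<r}\<close> show "j \<in> (\<Union>i<length ns. S i)"
      by (auto simp: S_def)
  qed
  then have "card {..<r} \<le> card (\<Union>i<length ns. S i)"
    by (intro card_mono) (auto simp: S_def)
  also have "\<dots> \<le> (\<Sum>i<length ns. card (S i))"
    by (rule card_UN_le) simp
  finally show ?thesis
    using card_S sum_bounded_above[of "{..<length ns}" "\<lambda>i. card (S i)" 1] by simp
qed

text \<open>One period of the walk is injective with as many entries as there are vertices, hence
  Hamiltonian.\<close>

lemma max_run_length_ge:
  assumes "is_torus ns" "has_run ns r"
  shows "max_run_length ns \<ge> r"
proof -
  define T where "T = prod_list ns"
  have T0: "T > 0"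
    using assms(1) unfolding T_def is_torus_def by (induction ns) auto
  have verts: "finite (torus_verts ns)" "card (torus_verts ns) = T"
    using finite_card_torus_verts by (simp_all add: T_def)
  obtain h c where hc: "long_run_walk ns r h c"
    using assms(2) by (auto simp: has_run_def)
  then have inj: "inj_on h {..<T}" and edge: "edge_in_dim ns (c j) (h j) (h (Suc j))"
    and per: "h (j + T) = h j" and run: "inj_on c {j..<j + r}" for j
    by (simp_all add: long_run_walk_def T_def)
  define H where "H = map h [0..<T]"
  have len: "length H = T" by (simp add: H_def)
  have H_nth: "H ! (j mod T) = h j" for j
    using T0 periodic_mod[of h T j, OF per] by (simp add: H_def)
  have "h ` {..<T} = torus_verts ns"
  proof (rule card_subset_eq[OF verts(1)])
    show "h ` {..<T} \<subseteq> torus_verts ns"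
      using edge by (auto simp: edge_in_dim_def)
    show "card (h ` {..<T}) = card (torus_verts ns)"
      using inj by (simp add: card_image verts)
  qed
  moreover have "torus_adj ns (H ! j) (H ! (Suc j mod length H))" if "j < length H" for j
    using that edge[of j] H_nth[of j] H_nth[of "Suc j"] by (auto simp: torus_adj_def len)
  ultimately have ham: "hamiltonian_cycle ns H"
    using inj by (simp add: hamiltonian_cycle_def H_def distinct_map atLeast0LessThan)
  have run_ok: "run_ok ns H r"
    unfolding run_ok_def len H_nth
  proof (intro allI impI)
    fix s i
    let ?S = "{j. j < r \<and> edge_in_dim ns i (h (s + j)) (h (Suc (s + j)))}"
    have "j = j'" if "j \<in> ?S" "j' \<in> ?S" for j j'
    proof -
      have "c (s + j) = c (s + j')"
        using that edge edge_in_dim_unique[OF assms(1)] by blast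
      then have "s + j = s + j'"
        using that by (auto dest: inj_onD[OF run[of s]])
      then show ?thesis by simp
    qed
    then show "card ?S \<le> 1"
      by (simp add: card_le_Suc0_iff_eq)
  qed
  have "finite {r. run_ok ns H r}"
    using run_ok_le_length[OF ham] T0 len by (auto intro!: finite_subset[OF _ finite_atMost[of "length ns"]])
  then have "r \<le> run_length ns H"
    using run_ok by (simp add: run_length_def)
  also have "\<dots> \<le> max_run_length ns"
  proof -
    have "finite {h. hamiltonian_cycle ns h}"
      by (rule finite_subset[OF _ finite_subset_distinct[OF verts(1)]]) (auto simp: hamiltonian_cycle_def)
    then have "finite {run_length ns h | h. hamiltonian_cycle ns h}"
      by simp
    then show ?thesis
      unfolding max_run_length_def using ham by (intro Max_ge) auto
  qed
  finally show ?thesis .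
qed

lemma prime_power_dims:
  assumes "prime p" "is_torus ns" "card (torus_verts ns) = p ^ r" "n \<in> set ns"
  shows "\<exists>e>0. n = p ^ e"
proof -
  have "prod_list ns = p ^ r"
    using assms(3) finite_card_torus_verts by metis
  moreover have "n dvd prod_list ns"
    using assms(4) by (induction ns) auto
  ultimately obtain e where e: "n = p ^ e"
    using assms(1) by (auto simp: divides_primepow_nat)
  moreover have "n \<ge> 2"
    using assms(2,4) by (simp add: is_torus_def)
  ultimately show ?thesis
    by (intro exI[of _ e]) (auto intro: gr0I)
qed

theorem mainTheorem4:
  fixes p k r :: nat and ns :: "nat list"
  assumes "prime p"
    and "k > 0"
    and "is_torus ns"
    and "length ns = k"
    and "r > 0"
    and "card (torus_verts ns) = p ^ r"
  shows "max_run_length ns \<ge> k div 3 + 1"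
proof -
  have "\<forall>n\<in>set ns. \<exists>e>0. n = p ^ e"
    using prime_power_dims assms(1,3,6) by blast
  moreover have "ns \<noteq> []"
    using assms(2,4) by auto
  ultimately have "has_run ns (k div 3 + 1)"
    using has_run_prime_powers[OF assms(1)] assms(4) by blast
  then show ?thesis
    using max_run_length_ge[OF assms(3)] by blast
qed

end
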